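(* Let $M$ be a pointed metric space, let $Y$ be a Banach space over $\mathbb{K}$, and let $C\subseteq S_{Y^*}$ be one-norming for $Y$. (a) $F,G\in\operatorname{Lip}_0(M,Y)$ satisfy $F\perp_B G$ if and only if $0$ belongs to $$\operatorname{conv}\left\{\lim \theta_0\frac{y_n^*(G(s_n)-G(t_n))}{d(s_n,t_n)}\colon s_n,t_n\in M,\ s_n\neq t_n,\ y_n^*\in C,\ \theta_0\in\mathbb{T},\ \lim\frac{y_n^*(F(s_n)-F(t_n))}{d(s_n,t_n)}=\overline{\theta_0}\,\|F\|_L\right\}.$$ (b) $F\in\operatorname{Lip}_0(M,Y)$ is a smooth point if and only if the set $$\left\{\lim \theta_0\frac{y_n^*(G(s_n)-G(t_n))}{d(s_n,t_n)}\colon s_n,t_n\in M,\ s_n\neq t_n,\ y_n^*\in C,\ \theta_0\in\mathbb{T},\ \lim\frac{y_n^*(F(s_n)-F(t_n))}{d(s_n,t_n)}=\overline{\theta_0}\,\|F\|_L\right\}$$ is a singleton for every $G\in\operatorname{Lip}_0(M,Y)$.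
   Context: $\mathbb{K}$ is $\mathbb{R}$ or $\mathbb{C}$, and $\mathbb{T}$ is the set of modulus-one scalars of $\mathbb{K}$. A pointed metric space is a metric space $(M,d)$ with a distinguished point called $0$. $\operatorname{Lip}_0(M,Y)$ is the Banach space of all Lipschitz maps $F\colon M\to Y$ with $F(0)=0$, with norm $\|F\|_L=\sup\{\|F(t)-F(s)\|/d(t,s)\colon t,s\in M,\ t\neq s\}$. $S_{Y^*}$ is the unit sphere of the dual $Y^*$; $C\subseteq S_{Y^*}$ is one-norming for $Y$ if $\|y\|=\sup\{|y^*(y)|\colon y^*\in C\}$ for all $y\in Y$. In the displayed sets, $(s_n)$, $(t_n)$, $(y_n^* )$ are sequences indexed by $n\in\mathbb{N}$, and writing $\lim a_n$ for a bounded scalar sequence means that the sequence is required to be convergent. $x\perp_B y$ (Birkhoff-James orthogonality) means $\|x+\lambda y\|\geq\|x\|$ for all $\lambda\in\mathbb{K}$. A point $z$ of a Banach space $Z$ is smooth if $\{\phi\in Z^*\colon\|\phi\|=1,\ \phi(z)=\|z\|\}$ is a singleton. $\operatorname{conv}$ is the convex hull.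
   Formalization: Part (a) is stated for M having a point other than 0 and Y ≠ {0}; otherwise Lip_0(M,Y) = {0}, where 0 ⊥_B 0 but the displayed set and its convex hull are empty, so the equivalence fails. *)

theory Defs
  imports "HOL-Analysis.Analysis"
begin

section \<open>The scalar field\<close>

text \<open>
  The types of this class are \<^typ>\<open>real\<close> and \<^typ>\<open>complex\<close>, up to isometric isomorphism: the
  (automatically injective) map \<open>to_complex\<close> identifies the type with a subfield of the complex
  numbers, and that subfield is required to be the reals or everything.
\<close>

class rc_scalar = real_normed_field +
  fixes to_complex :: "'a \<Rightarrow> complex"
    and conjK :: "'a \<Rightarrow> 'a"
  assumes to_complex_add: "to_complex (x + y) = to_complex x + to_complex y"
    and to_complex_mult: "to_complex (x * y) = to_complex x * to_complex y"
    and to_complex_scaleR: "to_complex (r *\<^sub>R x) = r *\<^sub>R to_complex x"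
    and norm_to_complex: "norm (to_complex x) = norm x"
    and to_complex_conjK: "to_complex (conjK x) = cnj (to_complex x)"
    and range_to_complex: "range to_complex = \<real> \<or> range to_complex = UNIV"

instantiation real :: rc_scalar
begin

definition to_complex_real :: "real \<Rightarrow> complex" where
  "to_complex_real = complex_of_real"

definition conjK_real :: "real \<Rightarrow> real" where
  "conjK_real x = x"

instance
  by standard (auto simp: to_complex_real_def conjK_real_def scaleR_conv_of_real Reals_def)

end

instantiation complex :: rc_scalar
begin

definition to_complex_complex :: "complex \<Rightarrow> complex" where
  "to_complex_complex z = z"

definition conjK_complex :: "complex \<Rightarrow> complex" where
  "conjK_complex = cnj"

instance
  by standard (auto simp: to_complex_complex_def conjK_complex_def)

end


section \<open>Normed spaces over the scalar field\<close>

text \<open>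
  A normed space over \<open>'k\<close> is a real normed space together with a scalar multiplication by \<open>'k\<close>
  that extends the real one.
\<close>

locale normed_space_over = vector_space scaleK
  for scaleK :: "'k::rc_scalar \<Rightarrow> 'a::real_normed_vector \<Rightarrow> 'a" +
  assumes scale_of_real: "scaleK (of_real r) x = r *\<^sub>R x"
    and norm_scale: "norm (scaleK c x) = norm c * norm x"

definition dual_space :: "('k::rc_scalar \<Rightarrow> 'a::real_normed_vector \<Rightarrow> 'a) \<Rightarrow> ('a \<Rightarrow> 'k) set" where
  "dual_space scaleK = {f. bounded_linear f \<and> Vector_Spaces.linear scaleK (*) f}"

definition dual_sphere :: "('k::rc_scalar \<Rightarrow> 'a::real_normed_vector \<Rightarrow> 'a) \<Rightarrow> ('a \<Rightarrow> 'k) set" where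
  "dual_sphere scaleK = {f \<in> dual_space scaleK. onorm f = 1}"

text \<open>
  Suprema of nonnegative quantities are taken in \<open>[0, \<infinity>)\<close>, so that the supremum of the empty set
  is \<open>0\<close>; this is the role of \<open>insert 0\<close> here and in the Lipschitz norm below. It only matters
  for the zero space and for the one-point metric space.
\<close>

definition one_norming :: "('a::real_normed_vector \<Rightarrow> 'k::rc_scalar) set \<Rightarrow> bool" where
  "one_norming C \<longleftrightarrow> (\<forall>y. norm y = Sup (insert 0 {norm (f y) |f. f \<in> C}))"

definition birkhoff_orthogonal ::
    "('k::rc_scalar \<Rightarrow> 'a::real_normed_vector \<Rightarrow> 'a) \<Rightarrow> 'a \<Rightarrow> 'a \<Rightarrow> bool" where
  "birkhoff_orthogonal scaleK x y \<longleftrightarrow> (\<forall>c. norm (x + scaleK c y) \<ge> norm x)"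

definition smooth_point :: "('k::rc_scalar \<Rightarrow> 'a::real_normed_vector \<Rightarrow> 'a) \<Rightarrow> 'a \<Rightarrow> bool" where
  "smooth_point scaleK z \<longleftrightarrow>
     is_singleton {\<phi> \<in> dual_space scaleK. onorm \<phi> = 1 \<and> \<phi> z = of_real (norm z)}"


section \<open>The space of Lipschitz maps vanishing at the distinguished point\<close>

text \<open>
  A pointed metric space is a type of sort \<open>{metric_space, zero}\<close>: the class \<^class>\<open>zero\<close> has
  no axioms and merely provides the distinguished point \<open>0\<close>.
\<close>

typedef (overloaded) ('m::"{metric_space,zero}", 'y::real_normed_vector) lip0 =
  "{F :: 'm \<Rightarrow> 'y. (\<exists>L. lipschitz_on L UNIV F) \<and> F 0 = 0}"
  morphisms lip0_apply Abs_lip0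
  by (rule exI[of _ "\<lambda>_. 0"]) (auto intro!: exI[of _ 0] lipschitz_onI)

setup_lifting type_definition_lip0

lemma lip0_apply_0 [simp]: "lip0_apply F 0 = 0"
  using lip0_apply[of F] by simp

lemma lip0_eqI: "(\<And>x. lip0_apply F x = lip0_apply G x) \<Longrightarrow> F = G"
  by (metis ext lip0_apply_inject)

lemma lip0_lipschitz: "\<exists>L. lipschitz_on L UNIV (lip0_apply F)"
  using lip0_apply[of F] by simp

instantiation lip0 :: ("{metric_space,zero}", real_normed_vector) real_vector
begin

lift_definition zero_lip0 :: "('a, 'b) lip0" is "\<lambda>_. 0"
  by (auto intro!: exI[of _ 0] lipschitz_onI)

lift_definition plus_lip0 :: "('a, 'b) lip0 \<Rightarrow> ('a, 'b) lip0 \<Rightarrow> ('a, 'b) lip0"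
  is "\<lambda>F G x. F x + G x"
  by (auto intro: lipschitz_on_add)

lift_definition uminus_lip0 :: "('a, 'b) lip0 \<Rightarrow> ('a, 'b) lip0" is "\<lambda>F x. - F x"
  by (auto intro: lipschitz_on_minus)

lift_definition minus_lip0 :: "('a, 'b) lip0 \<Rightarrow> ('a, 'b) lip0 \<Rightarrow> ('a, 'b) lip0"
  is "\<lambda>F G x. F x - G x"
  by (auto intro: lipschitz_on_diff)

lift_definition scaleR_lip0 :: "real \<Rightarrow> ('a, 'b) lip0 \<Rightarrow> ('a, 'b) lip0"
  is "\<lambda>r F x. r *\<^sub>R F x"
  by (auto intro: lipschitz_on_cmult)

instance
  by standard (auto intro!: lip0_eqI simp: zero_lip0.rep_eq plus_lip0.rep_eq uminus_lip0.rep_eq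
      minus_lip0.rep_eq scaleR_lip0.rep_eq algebra_simps)

end

instantiation lip0 :: ("{metric_space,zero}", real_normed_vector) real_normed_vector
begin

definition norm_lip0 :: "('a, 'b) lip0 \<Rightarrow> real" where
  "norm_lip0 F =
     Sup (insert 0 {norm (lip0_apply F t - lip0_apply F s) / dist t s |s t. t \<noteq> s})"

definition dist_lip0 :: "('a, 'b) lip0 \<Rightarrow> ('a, 'b) lip0 \<Rightarrow> real" where
  "dist_lip0 F G = norm (F - G)"

definition sgn_lip0 :: "('a, 'b) lip0 \<Rightarrow> ('a, 'b) lip0" where
  "sgn_lip0 F = F /\<^sub>R norm F"

definition uniformity_lip0 :: "(('a, 'b) lip0 \<times> ('a, 'b) lip0) filter" where
  "uniformity_lip0 = (INF e\<in>{0<..}. principal {(F, G). dist F G < e})"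

definition open_lip0 :: "('a, 'b) lip0 set \<Rightarrow> bool" where
  "open_lip0 U \<longleftrightarrow> (\<forall>F\<in>U. \<forall>\<^sub>F (F', G) in uniformity. F' = F \<longrightarrow> G \<in> U)"

lemma bdd_above_lip0:
  "bdd_above (insert 0 {norm (lip0_apply F t - lip0_apply F s) / dist t s |s t. t \<noteq> s})"
proof -
  obtain L where L: "lipschitz_on L UNIV (lip0_apply F)"
    using lip0_lipschitz by blast
  have "norm (lip0_apply F t - lip0_apply F s) / dist t s \<le> L" if "t \<noteq> s" for s t
    using lipschitz_onD[OF L, of t s] that by (simp add: dist_norm divide_le_eq)
  then show ?thesis
    by (auto intro!: bdd_aboveI[where M = "L"] lipschitz_on_nonneg[OF L])
qed

lemma lip0_norm_ge: "norm (lip0_apply F t - lip0_apply F s) \<le> norm F * dist t s"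
proof (cases "t = s")
  case False
  then have "norm (lip0_apply F t - lip0_apply F s) / dist t s \<le> norm F"
    unfolding norm_lip0_def by (intro cSup_upper bdd_above_lip0) auto
  then show ?thesis
    using False by (simp add: divide_le_eq)
qed simp

lemma lip0_norm_nonneg: "norm (F :: ('a, 'b) lip0) \<ge> 0"
  unfolding norm_lip0_def by (intro cSup_upper bdd_above_lip0) auto

lemma lip0_norm_le:
  fixes F :: "('a, 'b) lip0"
  assumes "0 \<le> L" and "\<And>s t. norm (lip0_apply F t - lip0_apply F s) \<le> L * dist t s"
  shows "norm F \<le> L"
  unfolding norm_lip0_def using assms
  by (intro cSup_least) (auto simp: divide_le_eq)

instance
proof
  fix F G :: "('a, 'b) lip0" and r :: real
  show "(norm F = 0) = (F = 0)"
  proof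
    assume "norm F = 0"
    then show "F = 0"
      using lip0_norm_ge[of F _ 0] by (intro lip0_eqI) (simp add: zero_lip0.rep_eq)
  next
    assume "F = 0"
    then show "norm F = 0"
      using lip0_norm_nonneg[of F] lip0_norm_le[of 0 F] by (simp add: zero_lip0.rep_eq)
  qed
  show "norm (F + G) \<le> norm F + norm G"
  proof (rule lip0_norm_le)
    fix s t :: 'a
    have "norm (lip0_apply (F + G) t - lip0_apply (F + G) s)
        \<le> norm (lip0_apply F t - lip0_apply F s) + norm (lip0_apply G t - lip0_apply G s)"
      unfolding plus_lip0.rep_eq by (metis add_diff_add norm_triangle_ineq)
    also have "\<dots> \<le> (norm F + norm G) * dist t s"
      using lip0_norm_ge[of F t s] lip0_norm_ge[of G t s] by (simp add: distrib_right)
    finally show "norm (lip0_apply (F + G) t - lip0_apply (F + G) s)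
        \<le> (norm F + norm G) * dist t s" .
  qed (simp add: lip0_norm_nonneg)
  have scale_le: "norm (r *\<^sub>R F) \<le> \<bar>r\<bar> * norm F" for r and F :: "('a, 'b) lip0"
    by (rule lip0_norm_le)
      (auto simp: lip0_norm_nonneg scaleR_lip0.rep_eq mult.assoc lip0_norm_ge mult_left_mono
        simp flip: scaleR_right_diff_distrib)
  show "norm (r *\<^sub>R F) = \<bar>r\<bar> * norm F"
  proof (cases "r = 0")
    case True
    then show ?thesis
      using scale_le[of r F] lip0_norm_nonneg[of "r *\<^sub>R F"] by simp
  next
    case False
    have "inverse r *\<^sub>R r *\<^sub>R F = F"
      using False by (intro lip0_eqI) (simp add: scaleR_lip0.rep_eq)
    then have "norm F \<le> \<bar>inverse r\<bar> * norm (r *\<^sub>R F)"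
      by (metis scale_le)
    then show ?thesis
      using scale_le[of r F] False by (simp add: abs_inverse field_simps)
  qed
qed (simp_all add: dist_lip0_def sgn_lip0_def uniformity_lip0_def open_lip0_def)

end

instance lip0 :: ("{metric_space,zero}", banach) banach
proof
  fix X :: "nat \<Rightarrow> ('a, 'b) lip0"
  assume X: "Cauchy X"
  have "Cauchy (\<lambda>n. lip0_apply (X n) x)" for x
  proof (rule metric_CauchyI)
    fix e :: real
    assume "e > 0"
    then have "e / (dist x 0 + 1) > 0"
      by (simp add: add_nonneg_pos)
    then obtain N where N: "\<And>m n. m \<ge> N \<Longrightarrow> n \<ge> N \<Longrightarrow> norm (X m - X n) < e / (dist x 0 + 1)"
      using X by (metis CauchyD)
    have "dist (lip0_apply (X m) x) (lip0_apply (X n) x) < e" if "m \<ge> N" "n \<ge> N" for m n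
    proof -
      have "dist (lip0_apply (X m) x) (lip0_apply (X n) x) \<le> norm (X m - X n) * dist x 0"
        using lip0_norm_ge[of "X m - X n" x 0] by (simp add: minus_lip0.rep_eq dist_norm)
      also have "\<dots> \<le> norm (X m - X n) * (dist x 0 + 1)"
        by (intro mult_left_mono) auto
      also have "\<dots> < e"
        using N[OF that] by (simp add: pos_less_divide_eq add_nonneg_pos)
      finally show ?thesis .
    qed
    then show "\<exists>N. \<forall>m\<ge>N. \<forall>n\<ge>N. dist (lip0_apply (X m) x) (lip0_apply (X n) x) < e"
      by blast
  qed
  then have "\<exists>l. (\<lambda>n. lip0_apply (X n) x) \<longlonglongrightarrow> l" for x
    by (metis Cauchy_convergent_iff convergent_def)
  then obtain f where f: "\<And>x. (\<lambda>n. lip0_apply (X n) x) \<longlonglongrightarrow> f x"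
    by metis
  have tail: "norm ((lip0_apply (X n) t - f t) - (lip0_apply (X n) s - f s)) \<le> e * dist t s"
    if "\<And>m. m \<ge> N \<Longrightarrow> norm (X n - X m) \<le> e" for n N e s t
  proof (rule tendsto_upperbound)
    show "(\<lambda>m. norm ((lip0_apply (X n) t - lip0_apply (X m) t)
        - (lip0_apply (X n) s - lip0_apply (X m) s)))
        \<longlonglongrightarrow> norm ((lip0_apply (X n) t - f t) - (lip0_apply (X n) s - f s))"
      by (intro tendsto_intros f)
    show "\<forall>\<^sub>F m in sequentially. norm ((lip0_apply (X n) t - lip0_apply (X m) t)
        - (lip0_apply (X n) s - lip0_apply (X m) s)) \<le> e * dist t s"
      using eventually_ge_at_top[of N]
    proof eventually_elim
      case (elim m)
      show ?case
        using lip0_norm_ge[of "X n - X m" t s] mult_right_mono[OF that[OF elim], of "dist t s"]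
        by (simp add: minus_lip0.rep_eq)
    qed
  qed simp
  obtain N where N: "\<And>m n. m \<ge> N \<Longrightarrow> n \<ge> N \<Longrightarrow> norm (X m - X n) < 1"
    using X by (metis CauchyD zero_less_one)
  have "lipschitz_on 1 UNIV (\<lambda>x. lip0_apply (X N) x - f x)"
    using tail[of N N 1] N[of N] by (intro lipschitz_onI) (auto simp: dist_norm less_imp_le)
  moreover obtain L where "lipschitz_on L UNIV (lip0_apply (X N))"
    using lip0_lipschitz by blast
  ultimately have "lipschitz_on (L + 1) UNIV
      (\<lambda>x. lip0_apply (X N) x - (lip0_apply (X N) x - f x))"
    by (intro lipschitz_on_diff)
  moreover have "f 0 = 0"
    using f[of 0] by (simp add: LIMSEQ_const_iff)
  ultimately have F: "lip0_apply (Abs_lip0 f) = f"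
    by (intro Abs_lip0_inverse) auto
  have "X \<longlonglongrightarrow> Abs_lip0 f"
  proof (rule LIMSEQ_I)
    fix e :: real
    assume "e > 0"
    then obtain N where N: "\<And>m n. m \<ge> N \<Longrightarrow> n \<ge> N \<Longrightarrow> norm (X m - X n) < e / 2"
      using X by (metis CauchyD half_gt_zero)
    have "norm (X n - Abs_lip0 f) \<le> e / 2" if "n \<ge> N" for n
      using tail[of N n "e / 2"] N[OF that] \<open>e > 0\<close>
      by (intro lip0_norm_le) (auto simp: minus_lip0.rep_eq F less_imp_le)
    then show "\<exists>N. \<forall>n\<ge>N. norm (X n - Abs_lip0 f) < e"
      using \<open>e > 0\<close> by (intro exI[of _ N]) fastforce
  qed
  then show "convergent X"
    by (rule convergentI)
qed

text \<open>
  The pointwise scalar multiplication on the space of Lipschitz maps. If \<open>scaleK\<close> is not the scalar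
  multiplication of a normed space, its value is arbitrary.
\<close>

definition lip0_scale :: "('k::rc_scalar \<Rightarrow> 'y::real_normed_vector \<Rightarrow> 'y)
    \<Rightarrow> 'k \<Rightarrow> ('m::{metric_space,zero}, 'y) lip0 \<Rightarrow> ('m, 'y) lip0" where
  "lip0_scale scaleK c F = Abs_lip0 (\<lambda>x. scaleK c (lip0_apply F x))"

context normed_space_over
begin

lemma lip0_apply_scale: "lip0_apply (lip0_scale scaleK c F) x = scaleK c (lip0_apply F x)"
proof -
  have "lipschitz_on (norm c * norm F) UNIV (\<lambda>x. scaleK c (lip0_apply F x))"
  proof (rule lipschitz_onI)
    fix t s
    have "dist (scaleK c (lip0_apply F t)) (scaleK c (lip0_apply F s))
        = norm c * norm (lip0_apply F t - lip0_apply F s)"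
      by (simp add: dist_norm norm_scale flip: scale_right_diff_distrib)
    also have "\<dots> \<le> norm c * norm F * dist t s"
      using lip0_norm_ge[of F t s] by (simp add: mult.assoc mult_left_mono)
    finally show "dist (scaleK c (lip0_apply F t)) (scaleK c (lip0_apply F s))
        \<le> norm c * norm F * dist t s" .
  qed simp
  then have "(\<lambda>x. scaleK c (lip0_apply F x)) \<in> {F. (\<exists>L. lipschitz_on L UNIV F) \<and> F 0 = 0}"
    by auto
  then show ?thesis
    unfolding lip0_scale_def by (simp add: Abs_lip0_inverse)
qed

lemma normed_space_over_lip0:
  "normed_space_over
     (lip0_scale scaleK :: 'k \<Rightarrow> ('m::{metric_space,zero}, 'a) lip0 \<Rightarrow> ('m, 'a) lip0)"
proof
  fix c d :: 'k and r :: real and F G :: "('m, 'a) lip0"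
  let ?s = "lip0_scale scaleK"
  show "?s c (F + G) = ?s c F + ?s c G"
    by (rule lip0_eqI) (simp add: lip0_apply_scale plus_lip0.rep_eq scale_right_distrib)
  show "?s (c + d) F = ?s c F + ?s d F"
    by (rule lip0_eqI) (simp add: lip0_apply_scale plus_lip0.rep_eq scale_left_distrib)
  show "?s c (?s d F) = ?s (c * d) F"
    by (rule lip0_eqI) (simp add: lip0_apply_scale)
  show "?s 1 F = F"
    by (rule lip0_eqI) (simp add: lip0_apply_scale)
  show "?s (of_real r) F = r *\<^sub>R F"
    by (rule lip0_eqI) (simp add: lip0_apply_scale scale_of_real scaleR_lip0.rep_eq)
  have le: "norm (?s c F) \<le> norm c * norm F" for c and F :: "('m, 'a) lip0"
    by (rule lip0_norm_le)
      (auto simp: lip0_apply_scale norm_scale mult.assoc lip0_norm_ge mult_left_mono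
        simp flip: scale_right_diff_distrib)
  show "norm (?s c F) = norm c * norm F"
  proof (cases "c = 0")
    case True
    then show ?thesis
      using le[of c F] by simp
  next
    case False
    have "?s (inverse c) (?s c F) = F"
      using False by (intro lip0_eqI) (simp add: lip0_apply_scale)
    then have "norm F \<le> inverse (norm c) * norm (?s c F)"
      by (metis le norm_inverse)
    then have "norm c * norm F \<le> norm (?s c F)"
      using False by (simp add: inverse_eq_divide pos_le_divide_eq mult.commute)
    then show ?thesis
      using le[of c F] by simp
  qed
qed

end


section \<open>The limit set\<close>

definition limit_set :: "('y::real_normed_vector \<Rightarrow> 'k::rc_scalar) set
    \<Rightarrow> ('m::{metric_space,zero}, 'y) lip0 \<Rightarrow> ('m, 'y) lip0 \<Rightarrow> 'k set" where
  "limit_set C F G = {l. \<exists>s t y \<theta>.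
     (\<forall>n::nat. s n \<noteq> t n \<and> y n \<in> C) \<and> norm \<theta> = 1 \<and>
     (\<lambda>n. y n (lip0_apply F (s n) - lip0_apply F (t n)) / of_real (dist (s n) (t n)))
       \<longlonglongrightarrow> conjK \<theta> * of_real (norm F) \<and>
     (\<lambda>n. \<theta> * (y n (lip0_apply G (s n) - lip0_apply G (t n)) / of_real (dist (s n) (t n))))
       \<longlonglongrightarrow> l}"

end

theory Submission
  imports Defs
begin

text \<open>
  Call \<open>H \<mapsto> \<theta> y\<^sup>*(H(s) - H(t)) / d(s, t)\<close> with \<open>y\<^sup>* \<in> C\<close> and \<open>\<bar>\<theta>\<bar> = 1\<close> an elementary functional.
  The pointwise closure \<open>K\<close> of the set of elementary functionals is compact by Tychonoff's theorem
  and consists of functionals of norm at most \<open>1\<close>; every \<open>H\<close> attains its norm on \<open>K\<close>, and the limit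
  set of \<open>F\<close> and \<open>G\<close> is \<open>{\<phi>(G). \<phi> \<in> K, \<phi>(F) = \<parallel>F\<parallel>}\<close>. Letting \<open>r \<rightarrow> 0\<close> in elements of \<open>K\<close> norming
  \<open>F + r c G\<close>, one sees that a lower bound \<open>\<parallel>F\<parallel> + r \<beta>\<close> for \<open>\<parallel>F + r c G\<parallel>\<close> yields a point \<open>l\<close>
  of the limit set with \<open>Re (c l) \<ge> \<beta>\<close>. For (a), separate \<open>0\<close> from the compact convex hull. For (b),
  a support functional \<open>\<phi>\<close> at \<open>F\<close> gives the bound with \<open>\<beta> = Re (c \<phi>(G))\<close> for every \<open>c\<close>, so that a
  singleton limit set must be \<open>{\<phi>(G)}\<close>.
\<close>

section \<open>The scalar field inside the complex numbers\<close>

lemma to_complex_of_real [simp]: "to_complex (of_real r :: 'k::rc_scalar) = of_real r"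
proof -
  have "to_complex (1::'k) * to_complex (1::'k) = to_complex (1::'k)"
    by (simp flip: to_complex_mult)
  moreover have "to_complex (1::'k) \<noteq> 0"
    using norm_to_complex[of "1::'k"] by auto
  ultimately have "to_complex (1::'k) = 1"
    by simp
  then show ?thesis
    by (metis of_real_def to_complex_scaleR)
qed

lemma bounded_linear_to_complex: "bounded_linear (to_complex :: 'k::rc_scalar \<Rightarrow> complex)"
  by (rule bounded_linear_intro[where K = 1])
    (auto simp: to_complex_add to_complex_scaleR norm_to_complex)

lemma to_complex_diff: "to_complex (x - y) = to_complex x - to_complex y"
  using bounded_linear_to_complex by (rule linear_simps)

lemma to_complex_minus: "to_complex (- x) = - to_complex x"
  using bounded_linear_to_complex by (rule linear_simps)

lemma dist_to_complex: "dist (to_complex x) (to_complex y) = dist x y"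
  by (simp add: dist_norm norm_to_complex flip: to_complex_diff)

lemma to_complex_eq_iff: "to_complex x = to_complex y \<longleftrightarrow> x = y"
  by (metis dist_eq_0_iff dist_to_complex)

lemma to_complex_eq_0_iff [simp]: "to_complex x = 0 \<longleftrightarrow> x = 0"
  by (metis norm_eq_zero norm_to_complex)

lemma closed_range_to_complex: "closed (range (to_complex :: 'k::rc_scalar \<Rightarrow> complex))"
  using range_to_complex[where 'a = 'k] by (auto simp: closed_complex_Reals)

text \<open>A bounded sequence has a subsequence converging in the complex numbers, and the closed
  range of \<open>to_complex\<close> keeps its limit in the scalar field. This makes closed balls of
  scalars compact.\<close>

instance rc_scalar \<subseteq> heine_borel
proof
  fix f :: "nat \<Rightarrow> 'a"
  assume "bounded (range f)"
  then have "bounded (range (\<lambda>n. to_complex (f n)))"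
    by (simp add: bounded_iff norm_to_complex)
  then obtain l and r :: "nat \<Rightarrow> nat"
    where r: "strict_mono r" and l: "((\<lambda>n. to_complex (f n)) \<circ> r) \<longlonglongrightarrow> l"
    using bounded_imp_convergent_subsequence by blast
  have "l \<in> range (to_complex :: 'a \<Rightarrow> complex)"
    by (rule Lim_in_closed_set[OF closed_range_to_complex _ _ l]) auto
  then obtain k :: 'a where "l = to_complex k"
    by auto
  then have "(f \<circ> r) \<longlonglongrightarrow> k"
    using l by (simp add: tendsto_iff dist_to_complex o_def)
  then show "\<exists>l r. strict_mono (r :: nat \<Rightarrow> nat) \<and> (f \<circ> r) \<longlonglongrightarrow> l"
    using r by blast
qed

lemma mult_conjK: "x * conjK x = of_real ((norm x)\<^sup>2)" for x :: "'k::rc_scalar"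
proof -
  have "to_complex (x * conjK x) = to_complex (of_real ((norm x)\<^sup>2) :: 'k)"
    by (simp add: to_complex_mult to_complex_conjK norm_to_complex del: of_real_power flip: complex_norm_square)
  then show ?thesis
    by (simp only: to_complex_eq_iff)
qed

lemma tendsto_conjK:
  assumes "(f \<longlongrightarrow> (l::'k::rc_scalar)) A"
  shows "((\<lambda>x. conjK (f x)) \<longlongrightarrow> conjK l) A"
proof -
  have "dist (conjK x) (conjK y) = dist x y" for x y :: 'k
    by (metis complex_cnj_diff complex_mod_cnj dist_norm dist_to_complex to_complex_conjK)
  then show ?thesis
    using assms by (simp add: tendsto_iff)
qed

lemma ex_rotation_to_norm: "\<exists>\<theta>. norm \<theta> = 1 \<and> \<theta> * z = of_real (norm z)" for z :: "'k::rc_scalar"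
proof (cases "z = 0")
  case True
  then show ?thesis
    by (intro exI[of _ 1]) simp
next
  case False
  then show ?thesis
    by (intro exI[of _ "of_real (norm z) / z"]) (simp add: norm_divide)
qed

text \<open>Turns a real hyperplane in the complex numbers into a scalar direction \<open>c\<close>.
  Over the reals only the real part of \<open>a\<close> matters; over the complex numbers
  \<open>c\<close> is the conjugate of \<open>a\<close>.\<close>

lemma ex_scalar_inner:
  "\<exists>c. \<forall>l::'k::rc_scalar. Re (to_complex (c * l)) = inner a (to_complex l)"
proof -
  consider "range (to_complex :: 'k \<Rightarrow> complex) = \<real>" | "range (to_complex :: 'k \<Rightarrow> complex) = UNIV"
    using range_to_complex by blast
  then show ?thesis
  proof cases
    case 1
    have "Im (to_complex l) = 0" for l :: 'k
      using 1 complex_is_Real_iff by blast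
    then show ?thesis
      by (intro exI[of _ "of_real (Re a)"]) (simp add: to_complex_mult inner_complex_def)
  next
    case 2
    then obtain c :: 'k where "to_complex c = cnj a"
      by (metis UNIV_I imageE)
    then show ?thesis
      by (intro exI[of _ c]) (simp add: to_complex_mult inner_complex_def)
  qed
qed

text \<open>The inserted \<open>0\<close> is harmless for a nonempty set of nonnegative numbers: if
  it is what exceeds \<open>x\<close>, so does any element of \<open>A\<close>.\<close>

lemma exists_gt_of_lt_Sup_insert_0:
  fixes A :: "real set"
  assumes "x < Sup (insert 0 A)" and "A \<noteq> {}" and "\<And>a. a \<in> A \<Longrightarrow> 0 \<le> a"
  shows "\<exists>a\<in>A. x < a"
proof -
  obtain b where "b \<in> insert 0 A" "x < b"
    using assms(1) by (metis insert_not_empty less_cSupE)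
  then show ?thesis
    using assms(2,3) by fastforce
qed

section \<open>Elementary functionals and their pointwise closure\<close>

text \<open>Absorbing the rotation \<theta> into the functional turns the limit condition on
  \<open>F\<close> into \<phi>(F) = ||F||, free of conjugates.\<close>

definition elementary_functionals ::
    "('y::real_normed_vector \<Rightarrow> 'k::rc_scalar) set \<Rightarrow> (('m::{metric_space,zero}, 'y) lip0 \<Rightarrow> 'k) set" where
  "elementary_functionals C =
     {\<lambda>H. \<theta> * (y (lip0_apply H s - lip0_apply H t) / of_real (dist s t)) |\<theta> y s t.
        norm \<theta> = 1 \<and> y \<in> C \<and> s \<noteq> t}"

text \<open>The function type carries the product topology, so this is closure under pointwise
  convergence.\<close>

abbreviation limit_functionals ::
    "('y::real_normed_vector \<Rightarrow> 'k::rc_scalar) set \<Rightarrow> (('m::{metric_space,zero}, 'y) lip0 \<Rightarrow> 'k) set" where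
  "limit_functionals C \<equiv> closure (elementary_functionals C)"

text \<open>The compactness half of Banach-Alaoglu, without linearity: the set is the product of the
  balls \<open>cball 0 (norm x)\<close>, each compact by the Heine-Borel property.\<close>

lemma compact_pointwise_ball:
  "compact {\<phi> :: 'a::real_normed_vector \<Rightarrow> 'k::{heine_borel,real_normed_vector}. \<forall>x. norm (\<phi> x) \<le> norm x}"
proof -
  have "compactin (product_topology (\<lambda>x::'a. euclidean :: 'k topology) UNIV)
      (Pi\<^sub>E UNIV (\<lambda>x. cball 0 (norm x)))"
    by (simp add: compactin_PiE)
  moreover have "Pi\<^sub>E UNIV (\<lambda>x. cball 0 (norm x))
      = {\<phi> :: 'a \<Rightarrow> 'k. \<forall>x. norm (\<phi> x) \<le> norm x}"
    by (auto simp: PiE_def Pi_def)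
  ultimately show ?thesis
    by (simp add: euclidean_product_topology)
qed

section \<open>Elementary properties of dual functionals\<close>

lemma dual_space_add:
  assumes "\<phi> \<in> dual_space s"
  shows "\<phi> (x + y) = \<phi> x + \<phi> y"
  using assms bounded_linear.linear linear_add by (fastforce simp: dual_space_def)

lemma dual_space_diff:
  assumes "\<phi> \<in> dual_space s"
  shows "\<phi> (x - y) = \<phi> x - \<phi> y"
  using assms bounded_linear.linear linear_diff by (fastforce simp: dual_space_def)

lemma dual_space_scale:
  assumes "\<phi> \<in> dual_space s"
  shows "\<phi> (s c x) = c * \<phi> x"
  using assms by (auto simp: dual_space_def Vector_Spaces.linear_def module_hom_def module_hom_axioms_def
      linear_iff)

lemma dual_space_norm_le:
  assumes "\<phi> \<in> dual_space s" "onorm \<phi> = 1"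
  shows "norm (\<phi> x) \<le> norm x"
  using onorm[of \<phi> x] assms by (simp add: dual_space_def)

context normed_space_over
begin

lemma dual_spaceI:
  assumes "\<And>x y. \<phi> (x + y) = \<phi> x + \<phi> y" "\<And>c x. \<phi> (scaleK c x) = c * \<phi> x"
    and "\<And>x. norm (\<phi> x) \<le> norm x"
  shows "\<phi> \<in> dual_space scaleK"
proof -
  have "bounded_linear \<phi>"
    by (rule bounded_linear_intro[where K = 1])
      (use assms in \<open>auto simp: scaleR_conv_of_real simp flip: scale_of_real\<close>)
  moreover have "Vector_Spaces.linear scaleK (*) \<phi>"
    by unfold_locales (use assms in \<open>auto simp: algebra_simps\<close>)
  ultimately show ?thesis
    by (simp add: dual_space_def)
qed

lemma dual_space_uminus:
  assumes "\<phi> \<in> dual_space scaleK" "onorm \<phi> = 1"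
  shows "(\<lambda>x. - \<phi> x) \<in> dual_space scaleK"
  using dual_space_norm_le[OF assms] assms(1)
  by (intro dual_spaceI) (auto simp: dual_space_add dual_space_scale)

end

locale one_norming_functionals = normed_space_over scaleK
  for scaleK :: "'k::rc_scalar \<Rightarrow> 'y::real_normed_vector \<Rightarrow> 'y" +
  fixes C :: "('y \<Rightarrow> 'k) set"
  assumes C: "C \<subseteq> dual_sphere scaleK" and one_norming: "one_norming C"
begin

interpretation lip0: normed_space_over
  "lip0_scale scaleK :: 'k \<Rightarrow> ('m::{metric_space,zero}, 'y) lip0 \<Rightarrow> _"
  by (rule normed_space_over_lip0)

lemma C_dual: "y \<in> C \<Longrightarrow> y \<in> dual_space scaleK" "y \<in> C \<Longrightarrow> onorm y = 1"
  using C by (auto simp: dual_sphere_def)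

lemma ex_norming_functional:
  assumes "x < norm v" and "\<exists>y::'y. y \<noteq> 0"
  shows "\<exists>f\<in>C. x < norm (f v)"
proof -
  obtain y :: 'y where "y \<noteq> 0"
    using assms(2) by blast
  \<comment> \<open>With the convention that the supremum over an empty family is \<open>0\<close>,
    an empty \<open>C\<close> would make every norm vanish.\<close>
  have "C \<noteq> {}"
  proof
    assume "C = {}"
    then have "norm y = 0"
      using one_norming unfolding one_norming_def by simp
    with \<open>y \<noteq> 0\<close> show False
      by simp
  qed
  have "x < Sup (insert 0 {norm (f v) |f. f \<in> C})"
    using assms(1) one_norming unfolding one_norming_def by auto
  then have "\<exists>a\<in>{norm (f v) |f. f \<in> C}. x < a"
    by (rule exists_gt_of_lt_Sup_insert_0) (use \<open>C \<noteq> {}\<close> in auto)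
  then show ?thesis
    by auto
qed

lemma elementary_add:
  assumes "\<phi> \<in> elementary_functionals C"
  shows "\<phi> (G + H) = \<phi> G + \<phi> H"
proof -
  obtain \<theta> y s t where \<phi>: "\<phi> = (\<lambda>H. \<theta> * (y (lip0_apply H s - lip0_apply H t) / of_real (dist s t)))"
    and "y \<in> C"
    using assms by (auto simp: elementary_functionals_def)
  have "y ((a + b) - (c + d)) = y (a - c) + y (b - d)" for a b c d
    using dual_space_add[OF C_dual(1)[OF \<open>y \<in> C\<close>]] by (metis add_diff_add)
  then show ?thesis
    by (simp add: \<phi> plus_lip0.rep_eq add_divide_distrib distrib_left)
qed

lemma elementary_scale:
  assumes "\<phi> \<in> elementary_functionals C"
  shows "\<phi> (lip0_scale scaleK c H) = c * \<phi> H"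
proof -
  obtain \<theta> y s t where \<phi>: "\<phi> = (\<lambda>H. \<theta> * (y (lip0_apply H s - lip0_apply H t) / of_real (dist s t)))"
    and "y \<in> C"
    using assms by (auto simp: elementary_functionals_def)
  have "y (scaleK c a - scaleK c b) = c * y (a - b)" for a b
    using dual_space_scale[OF C_dual(1)[OF \<open>y \<in> C\<close>]] by (simp flip: scale_right_diff_distrib)
  then show ?thesis
    by (simp add: \<phi> lip0_apply_scale)
qed

lemma elementary_norm_le:
  assumes "\<phi> \<in> elementary_functionals C"
  shows "norm (\<phi> H) \<le> norm H"
proof -
  obtain \<theta> y s t where \<phi>: "\<phi> = (\<lambda>H. \<theta> * (y (lip0_apply H s - lip0_apply H t) / of_real (dist s t)))"
    and *: "norm \<theta> = 1" "y \<in> C" "s \<noteq> t"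
    using assms by (auto simp: elementary_functionals_def)
  have "norm (y (lip0_apply H s - lip0_apply H t)) \<le> norm (lip0_apply H s - lip0_apply H t)"
    using C_dual[OF *(2)] by (rule dual_space_norm_le)
  also have "\<dots> \<le> norm H * dist s t"
    by (rule lip0_norm_ge)
  finally show ?thesis
    using * by (simp add: \<phi> norm_mult norm_divide divide_le_eq)
qed

text \<open>An identity between finitely many evaluations is a closed condition under pointwise
  convergence, so it passes from elementary functionals to their closure. The next two lemmas use
  the same principle.\<close>

lemma limit_functional_add:
  assumes "\<phi> \<in> limit_functionals C"
  shows "\<phi> (G + H) = \<phi> G + \<phi> H"
proof -
  have "limit_functionals C \<subseteq> {\<phi>. \<phi> (G + H) = \<phi> G + \<phi> H}"
    by (intro closure_minimal subsetI CollectI closed_Collect_eq continuous_intros elementary_add) auto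
  with assms show ?thesis by auto
qed

lemma limit_functional_scale:
  assumes "\<phi> \<in> limit_functionals C"
  shows "\<phi> (lip0_scale scaleK c H) = c * \<phi> H"
proof -
  have "limit_functionals C \<subseteq> {\<phi>. \<phi> (lip0_scale scaleK c H) = c * \<phi> H}"
    by (intro closure_minimal subsetI CollectI closed_Collect_eq continuous_intros elementary_scale) auto
  with assms show ?thesis by auto
qed

lemma limit_functional_norm_le:
  assumes "\<phi> \<in> limit_functionals C"
  shows "norm (\<phi> H) \<le> norm H"
proof -
  have "limit_functionals C \<subseteq> {\<phi>. norm (\<phi> H) \<le> norm H}"
    by (intro closure_minimal subsetI CollectI closed_Collect_le continuous_intros elementary_norm_le) auto
  with assms show ?thesis by auto
qed

lemma limit_functional_dual:
  assumes "\<phi> \<in> limit_functionals C"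
  shows "\<phi> \<in> dual_space (lip0_scale scaleK)"
  by (rule lip0.dual_spaceI)
    (simp_all add: assms limit_functional_add limit_functional_scale limit_functional_norm_le)

lemma compact_limit_functionals:
  "compact (limit_functionals C :: (('m::{metric_space,zero}, 'y) lip0 \<Rightarrow> 'k) set)"
proof -
  let ?B = "{\<phi> :: ('m, 'y) lip0 \<Rightarrow> 'k. \<forall>H. norm (\<phi> H) \<le> norm H}"
  have "compact (?B \<inter> limit_functionals C)"
    by (rule compact_Int_closed[OF compact_pointwise_ball closed_closure])
  also have "?B \<inter> limit_functionals C = limit_functionals C"
    using limit_functional_norm_le by blast
  finally show ?thesis .
qed

text \<open>Sequences of limit functionals need not have pointwise convergent subsequences, but
  their values at two fixed maps do, and the limiting pair is again attained by one functional. This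
  allows all later arguments to use sequences.\<close>

lemma compact_evaluations: "compact ((\<lambda>\<phi>. (\<phi> F, \<phi> G)) ` limit_functionals C)"
  by (intro compact_continuous_image compact_limit_functionals continuous_on_Pair
      continuous_on_subset[OF continuous_on_product_coordinates] subset_UNIV)

section \<open>The limit set as a set of values of limit functionals\<close>

text \<open>Forwards, closedness of the evaluation pairs replaces the sequence by one functional.
  Backwards, \<phi> is approximated at \<open>F\<close> and \<open>G\<close> by elementary
  functionals, whose rotations converge along a subsequence.\<close>

lemma limit_set_eq:
  "limit_set C F G = {\<phi> G |\<phi>. \<phi> \<in> limit_functionals C \<and> \<phi> F = of_real (norm F)}"
proof (intro set_eqI iffI)
  fix l
  assume "l \<in> limit_set C F G"
  then obtain s t y \<theta> where st: "\<And>n::nat. s n \<noteq> t n \<and> y n \<in> C" and \<theta>: "norm \<theta> = 1"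
    and F: "(\<lambda>n. y n (lip0_apply F (s n) - lip0_apply F (t n)) / of_real (dist (s n) (t n)))
       \<longlonglongrightarrow> conjK \<theta> * of_real (norm F)"
    and G: "(\<lambda>n. \<theta> * (y n (lip0_apply G (s n) - lip0_apply G (t n)) / of_real (dist (s n) (t n))))
       \<longlonglongrightarrow> l"
    unfolding limit_set_def by blast
  define \<phi> where "\<phi> n =
    (\<lambda>H. \<theta> * (y n (lip0_apply H (s n) - lip0_apply H (t n)) / of_real (dist (s n) (t n))))" for n
  have "\<phi> n \<in> elementary_functionals C" for n
    using st \<theta> unfolding \<phi>_def elementary_functionals_def by (intro CollectI exI conjI refl) auto
  then have \<phi>: "\<phi> n \<in> limit_functionals C" for n
    using closure_subset by blast
  have "(\<lambda>n. \<phi> n F) \<longlonglongrightarrow> \<theta> * (conjK \<theta> * of_real (norm F))"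
    unfolding \<phi>_def by (intro tendsto_mult_left F)
  also have "\<theta> * (conjK \<theta> * of_real (norm F)) = of_real (norm F)"
    using mult_conjK[of \<theta>] \<theta> by (simp flip: mult.assoc)
  finally have "(\<lambda>n. (\<phi> n F, \<phi> n G)) \<longlonglongrightarrow> (of_real (norm F), l)"
    using G by (intro tendsto_Pair) (simp_all add: \<phi>_def)
  then have "(of_real (norm F), l) \<in> (\<lambda>\<phi>. (\<phi> F, \<phi> G)) ` limit_functionals C"
    by (rule Lim_in_closed_set[OF compact_imp_closed[OF compact_evaluations], rotated 2])
      (use \<phi> in auto)
  then show "l \<in> {\<phi> G |\<phi>. \<phi> \<in> limit_functionals C \<and> \<phi> F = of_real (norm F)}"
    by force
next
  fix l
  assume "l \<in> {\<phi> G |\<phi>. \<phi> \<in> limit_functionals C \<and> \<phi> F = of_real (norm F)}"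
  then obtain \<phi> where \<phi>: "\<phi> \<in> limit_functionals C" "\<phi> F = of_real (norm F)" and l: "l = \<phi> G"
    by auto
  have "\<exists>\<psi>\<in>elementary_functionals C. dist (\<psi> F) (\<phi> F) < e \<and> dist (\<psi> G) (\<phi> G) < e"
    if "e > 0" for e :: real
  proof -
    have "open {\<psi>. dist (\<psi> F) (\<phi> F) < e \<and> dist (\<psi> G) (\<phi> G) < e}"
      by (intro open_Collect_conj open_Collect_less continuous_intros) auto
    moreover have "\<phi> \<in> {\<psi>. dist (\<psi> F) (\<phi> F) < e \<and> dist (\<psi> G) (\<phi> G) < e}"
      using that by simp
    ultimately show ?thesis
      using \<phi>(1) unfolding closure_iff_nhds_not_empty by blast
  qed
  then have "\<exists>\<psi>\<in>elementary_functionals C. dist (\<psi> F) (\<phi> F) < inverse (Suc n)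
      \<and> dist (\<psi> G) (\<phi> G) < inverse (Suc n)" for n
    by simp
  then obtain \<psi> where \<psi>: "\<And>n. \<psi> n \<in> elementary_functionals C"
    and near: "\<And>n::nat. dist (\<psi> n F) (\<phi> F) < inverse (Suc n) \<and> dist (\<psi> n G) (\<phi> G) < inverse (Suc n)"
    by metis
  have F: "(\<lambda>n. \<psi> n F) \<longlonglongrightarrow> of_real (norm F)"
    by (rule metric_tendsto_imp_tendsto[OF LIMSEQ_inverse_real_of_nat])
      (use near \<phi>(2) in \<open>auto simp: less_imp_le\<close>)
  have G: "(\<lambda>n. \<psi> n G) \<longlonglongrightarrow> l"
    by (rule metric_tendsto_imp_tendsto[OF LIMSEQ_inverse_real_of_nat])
      (use near l in \<open>auto simp: less_imp_le\<close>)
  have "\<forall>n. \<exists>\<theta> y s t. \<psi> n = (\<lambda>H. \<theta> * (y (lip0_apply H s - lip0_apply H t) / of_real (dist s t)))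
      \<and> norm \<theta> = 1 \<and> y \<in> C \<and> s \<noteq> t"
    using \<psi> unfolding elementary_functionals_def by blast
  then obtain \<theta> y s t where
    \<psi>_eq: "\<And>n. \<psi> n = (\<lambda>H. \<theta> n * (y n (lip0_apply H (s n) - lip0_apply H (t n)) / of_real (dist (s n) (t n))))"
    and *: "\<And>n. norm (\<theta> n) = 1" "\<And>n. y n \<in> C" "\<And>n. s n \<noteq> t n"
    unfolding choice_iff by (elim exE) (rule that; blast)
  \<comment> \<open>The approximants have varying rotations, whereas \<open>limit_set\<close> asks
    for a single one; a subsequential limit \<open>\<theta>\<^sub>0\<close> serves.\<close>
  have "bounded (range \<theta>)"
    using *(1) by (auto simp: bounded_iff)
  then obtain \<theta>\<^sub>0 and r :: "nat \<Rightarrow> nat" where r: "strict_mono r" and \<theta>\<^sub>0: "(\<theta> \<circ> r) \<longlonglongrightarrow> \<theta>\<^sub>0"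
    using bounded_imp_convergent_subsequence by blast
  have norm_\<theta>\<^sub>0: "norm \<theta>\<^sub>0 = 1"
    using tendsto_norm[OF \<theta>\<^sub>0] *(1) by (simp add: o_def LIMSEQ_const_iff)
  \<comment> \<open>Since each \<theta> has modulus one, multiplying by its conjugate undoes the
    rotation.\<close>
  have quot: "y n (lip0_apply H (s n) - lip0_apply H (t n)) / of_real (dist (s n) (t n))
      = conjK (\<theta> n) * \<psi> n H" for n H
  proof -
    have "conjK (\<theta> n) * \<psi> n H = (\<theta> n * conjK (\<theta> n)) *
        (y n (lip0_apply H (s n) - lip0_apply H (t n)) / of_real (dist (s n) (t n)))"
      by (simp only: \<psi>_eq ac_simps)
    then show ?thesis
      by (simp add: mult_conjK *(1))
  qed
  have conj: "(\<lambda>n. conjK (\<theta> (r n))) \<longlonglongrightarrow> conjK \<theta>\<^sub>0"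
    using tendsto_conjK[OF \<theta>\<^sub>0] by (simp add: o_def)
  have "(\<lambda>n. conjK (\<theta> (r n)) * \<psi> (r n) F) \<longlonglongrightarrow> conjK \<theta>\<^sub>0 * of_real (norm F)"
    using LIMSEQ_subseq_LIMSEQ[OF F r] by (intro tendsto_mult conj) (simp add: o_def)
  moreover have "(\<lambda>n. \<theta>\<^sub>0 * (conjK (\<theta> (r n)) * \<psi> (r n) G)) \<longlonglongrightarrow> \<theta>\<^sub>0 * (conjK \<theta>\<^sub>0 * l)"
    using LIMSEQ_subseq_LIMSEQ[OF G r] by (intro tendsto_mult tendsto_const conj) (simp add: o_def)
  moreover have "\<theta>\<^sub>0 * (conjK \<theta>\<^sub>0 * l) = l"
    using mult_conjK[of \<theta>\<^sub>0] norm_\<theta>\<^sub>0 by (simp flip: mult.assoc)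
  ultimately show "l \<in> limit_set C F G"
    unfolding limit_set_def
    by (intro CollectI exI[of _ "\<lambda>n. s (r n)"] exI[of _ "\<lambda>n. t (r n)"] exI[of _ "\<lambda>n. y (r n)"]
        exI[of _ \<theta>\<^sub>0]) (simp add: quot * norm_\<theta>\<^sub>0)
qed

text \<open>The limit set is the slice of the compact set of evaluation pairs over the first
  coordinate \<open>norm F\<close>, projected to the second coordinate.\<close>

lemma compact_limit_set: "compact (limit_set C F G)"
proof -
  have "limit_set C F G =
      snd ` ((\<lambda>\<phi>. (\<phi> F, \<phi> G)) ` limit_functionals C \<inter> ({of_real (norm F)} \<times> UNIV))"
    unfolding limit_set_eq by force
  also have "compact \<dots>"
    by (intro compact_continuous_image[OF continuous_on_snd[OF continuous_on_id]]
        compact_Int_closed[OF compact_evaluations] closed_Times closed_singleton closed_UNIV)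
  finally show ?thesis .
qed

text \<open>A nearly optimal pair of points, a nearly norming element of \<open>C\<close> and a
  rotation give values arbitrarily close to \<open>norm H\<close>; compactness makes the bound
  attained. Nontriviality supplies the points and the functional. Diagonal pairs are used to fit
  \<open>compact_evaluations\<close>.\<close>

lemma ex_norm_attaining:
  fixes H :: "('m::{metric_space,zero}, 'y) lip0"
  assumes "\<exists>x::'m. x \<noteq> 0" "\<exists>y::'y. y \<noteq> 0"
  shows "\<exists>\<phi>\<in>limit_functionals C. \<phi> H = of_real (norm H)"
proof -
  have "\<exists>z\<in>(\<lambda>\<phi>. (\<phi> H, \<phi> H)) ` limit_functionals C. dist z (of_real (norm H), of_real (norm H)) < e"
    if "e > 0" for e
  proof -
    \<comment> \<open>The margin \<open>e / 2\<close> in each coordinate keeps the diagonal pair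
      within \<open>e\<close>.\<close>
    have "norm H - e / 2 < Sup (insert 0 {norm (lip0_apply H t - lip0_apply H s) / dist t s |s t. t \<noteq> s})"
      using that by (simp flip: norm_lip0_def)
    moreover have "{norm (lip0_apply H t - lip0_apply H s) / dist t s |s t. t \<noteq> s} \<noteq> {}"
      using assms(1) by auto
    ultimately obtain s t where st: "t \<noteq> s"
      and "norm H - e / 2 < norm (lip0_apply H t - lip0_apply H s) / dist t s"
      using exists_gt_of_lt_Sup_insert_0 by force
    then have "(norm H - e / 2) * dist t s < norm (lip0_apply H t - lip0_apply H s)"
      by (simp add: pos_less_divide_eq)
    then obtain y where y: "y \<in> C"
      "(norm H - e / 2) * dist t s < norm (y (lip0_apply H t - lip0_apply H s))"
      using ex_norming_functional assms(2) by blast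
    define q where "q = y (lip0_apply H t - lip0_apply H s) / of_real (dist t s)"
    have q: "norm H - e / 2 < norm q"
      using y(2) st by (simp add: q_def norm_divide pos_less_divide_eq)
    obtain \<theta> where \<theta>: "norm \<theta> = 1" "\<theta> * q = of_real (norm q)"
      using ex_rotation_to_norm by blast
    define \<phi> where "\<phi> = (\<lambda>H. \<theta> * (y (lip0_apply H t - lip0_apply H s) / of_real (dist t s)))"
    have "\<phi> \<in> elementary_functionals C"
      using \<theta>(1) y(1) st unfolding \<phi>_def elementary_functionals_def
      by (intro CollectI exI conjI refl) auto
    then have \<phi>: "\<phi> \<in> limit_functionals C"
      using closure_subset by blast
    have \<phi>H: "\<phi> H = of_real (norm q)"
      using \<theta>(2) by (simp add: \<phi>_def q_def)
    have "norm q \<le> norm H"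
      using limit_functional_norm_le[OF \<phi>, of H] by (simp add: \<phi>H)
    then have "dist (\<phi> H) (of_real (norm H)) < e / 2"
      using q by (simp add: \<phi>H dist_norm flip: of_real_diff)
    then have "dist (\<phi> H, \<phi> H) (of_real (norm H), of_real (norm H)) < e"
      using sqrt_sum_squares_le_sum_abs[of "dist (\<phi> H) (of_real (norm H))" "dist (\<phi> H) (of_real (norm H))"]
      by (simp add: dist_Pair_Pair)
    with \<phi> show ?thesis
      by blast
  qed
  then have "(of_real (norm H), of_real (norm H)) \<in> closure ((\<lambda>\<phi>. (\<phi> H, \<phi> H)) ` limit_functionals C)"
    unfolding closure_approachable by blast
  then have "(of_real (norm H), of_real (norm H)) \<in> (\<lambda>\<phi>. (\<phi> H, \<phi> H)) ` limit_functionals C"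
    by (simp add: compact_imp_closed[OF compact_evaluations])
  then show ?thesis
    by force
qed

section \<open>Directional growth of the norm\<close>

text \<open>A functional norming the perturbed map has real part at most \<open>norm F\<close> at
  \<open>F\<close>, so the perturbation must account for the whole growth. As the step tends to
  \<open>0\<close>, its value at \<open>F\<close> tends to \<open>norm F\<close>, and a limit of its
  values at \<open>G\<close> is the desired point.\<close>

lemma ex_limit_point_of_norm_growth:
  fixes F G :: "('m::{metric_space,zero}, 'y) lip0"
  assumes nontrivial: "\<exists>x::'m. x \<noteq> 0" "\<exists>y::'y. y \<noteq> 0"
    and growth: "\<And>r. 0 < r \<Longrightarrow> norm F + r * \<beta> \<le> norm (F + lip0_scale scaleK (of_real r * c) G)"
  shows "\<exists>l\<in>limit_set C F G. \<beta> \<le> Re (to_complex (c * l))"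
proof -
  define r where "r n = inverse (real (Suc n))" for n
  have r_pos: "r n > 0" for n
    by (simp add: r_def)
  define N where "N n = norm (F + lip0_scale scaleK (of_real (r n) * c) G)" for n
  have "\<exists>\<phi>\<in>limit_functionals C. \<phi> (F + lip0_scale scaleK (of_real (r n) * c) G) = of_real (N n)" for n
    unfolding N_def by (rule ex_norm_attaining[OF nontrivial])
  then obtain \<phi> where \<phi>: "\<And>n. \<phi> n \<in> limit_functionals C"
    and "\<And>n. \<phi> n (F + lip0_scale scaleK (of_real (r n) * c) G) = of_real (N n)"
    by metis
  then have sum: "\<phi> n F + of_real (r n) * (c * \<phi> n G) = of_real (N n)" for n
    by (simp add: limit_functional_add[OF \<phi>] limit_functional_scale[OF \<phi>] mult.assoc)
  have lower: "\<beta> \<le> Re (to_complex (c * \<phi> n G))" for n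
  proof -
    have "Re (to_complex (\<phi> n F)) \<le> norm F"
      using limit_functional_norm_le[OF \<phi>, of n F] complex_Re_le_cmod[of "to_complex (\<phi> n F)"]
      by (simp add: norm_to_complex)
    moreover have "Re (to_complex (\<phi> n F)) + r n * Re (to_complex (c * \<phi> n G)) = N n"
      using arg_cong[OF sum[of n], of "\<lambda>z. Re (to_complex z)"]
      by (simp add: to_complex_add to_complex_mult[of "of_real _"])
    moreover have "norm F + r n * \<beta> \<le> N n"
      using growth[OF r_pos] by (simp add: N_def)
    ultimately have "r n * \<beta> \<le> r n * Re (to_complex (c * \<phi> n G))"
      by linarith
    then show ?thesis
      using r_pos by simp
  qed
  have F: "(\<lambda>n. \<phi> n F) \<longlonglongrightarrow> of_real (norm F)"
  proof -
    let ?D = "norm c * norm G"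
    \<comment> \<open>One copy of \<open>r n * ?D\<close> bounds the change of the norm, the other
      the value of the functional on the perturbation.\<close>
    have bound: "dist (\<phi> n F) (of_real (norm F)) \<le> 2 * (r n * ?D)" for n
    proof -
      have "norm (of_real (r n) * (c * \<phi> n G)) \<le> r n * ?D"
        using r_pos[of n] limit_functional_norm_le[OF \<phi>, of n G]
        by (simp add: norm_mult mult_left_mono)
      moreover have "norm (of_real (N n - norm F) :: 'k) \<le> r n * ?D"
        using norm_triangle_ineq3[of "F + lip0_scale scaleK (of_real (r n) * c) G" F] r_pos[of n]
        by (simp add: N_def lip0.norm_scale norm_mult mult.assoc del: of_real_diff)
      moreover have "\<phi> n F - of_real (norm F) = of_real (N n - norm F) - of_real (r n) * (c * \<phi> n G)"
        using sum[of n] by (simp add: algebra_simps)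
      then have "dist (\<phi> n F) (of_real (norm F))
          \<le> norm (of_real (N n - norm F) :: 'k) + norm (of_real (r n) * (c * \<phi> n G))"
        unfolding dist_norm by (metis norm_triangle_ineq4)
      ultimately show ?thesis
        by linarith
    qed
    have "(\<lambda>n. 2 * (r n * ?D)) \<longlonglongrightarrow> 0"
      unfolding r_def
      by (intro tendsto_mult_right_zero tendsto_mult_left_zero LIMSEQ_inverse_real_of_nat)
    then show ?thesis
      by (rule metric_tendsto_imp_tendsto) (use bound r_pos in \<open>auto simp: less_imp_le\<close>)
  qed
  have "seq_compact ((\<lambda>\<phi>. (\<phi> F, \<phi> G)) ` limit_functionals C)"
    using compact_evaluations by (rule compact_imp_seq_compact)
  then obtain p and k :: "nat \<Rightarrow> nat" where p: "p \<in> (\<lambda>\<phi>. (\<phi> F, \<phi> G)) ` limit_functionals C"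
    and k: "strict_mono k" and lim: "((\<lambda>n. (\<phi> n F, \<phi> n G)) \<circ> k) \<longlonglongrightarrow> p"
    using \<phi> by (elim seq_compactE[where f = "\<lambda>n. (\<phi> n F, \<phi> n G)"]) blast+
  then obtain \<psi> where \<psi>: "\<psi> \<in> limit_functionals C" and p_eq: "p = (\<psi> F, \<psi> G)"
    by auto
  have limF: "(\<lambda>n. \<phi> (k n) F) \<longlonglongrightarrow> \<psi> F" and limG: "(\<lambda>n. \<phi> (k n) G) \<longlonglongrightarrow> \<psi> G"
    using tendsto_fst[OF lim] tendsto_snd[OF lim] by (simp_all add: p_eq o_def)
  have "\<psi> F = of_real (norm F)"
    using limF LIMSEQ_subseq_LIMSEQ[OF F k] LIMSEQ_unique by (force simp: o_def)
  moreover have "\<beta> \<le> Re (to_complex (c * \<psi> G))"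
  proof (rule tendsto_lowerbound)
    show "(\<lambda>n. Re (to_complex (c * \<phi> (k n) G))) \<longlonglongrightarrow> Re (to_complex (c * \<psi> G))"
      by (intro tendsto_Re bounded_linear.tendsto[OF bounded_linear_to_complex] tendsto_mult_left limG)
  qed (use lower in auto)
  ultimately show ?thesis
    using \<psi> unfolding limit_set_eq by blast
qed

section \<open>Birkhoff-James orthogonality and the convex hull\<close>

text \<open>For each \<open>c\<close>, evaluating limit functionals at the perturbed map shows that
  the limit set lies in the convex set \<open>?A\<close>. Hence so does \<open>0\<close>, which is
  the required inequality.\<close>

lemma orthogonal_if_0_in_hull:
  assumes "0 \<in> convex hull (limit_set C F G)"
  shows "birkhoff_orthogonal (lip0_scale scaleK) F G"
  unfolding birkhoff_orthogonal_def
proof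
  fix c
  let ?m = "norm (F + lip0_scale scaleK c G)" and ?h = "\<lambda>l. Re (to_complex (c * l))"
  let ?A = "{l. norm F + ?h l \<le> ?m}"
  have "linear ?h"
    by (intro linearI) (simp_all add: algebra_simps to_complex_add to_complex_scaleR)
  then have "convex (?h -` {..?m - norm F})"
    by (intro convex_linear_vimage) auto
  also have "?h -` {..?m - norm F} = ?A"
    by auto
  finally have "convex ?A" .
  moreover have "limit_set C F G \<subseteq> ?A"
  proof
    fix l
    assume "l \<in> limit_set C F G"
    then obtain \<phi> where \<phi>: "\<phi> \<in> limit_functionals C" "\<phi> F = of_real (norm F)" "l = \<phi> G"
      unfolding limit_set_eq by blast
    have "\<phi> (F + lip0_scale scaleK c G) = of_real (norm F) + c * l"
      by (simp add: limit_functional_add[OF \<phi>(1)] limit_functional_scale[OF \<phi>(1)] \<phi>(2,3))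
    then have "norm F + ?h l = Re (to_complex (\<phi> (F + lip0_scale scaleK c G)))"
      by (simp add: to_complex_add)
    also have "\<dots> \<le> norm (\<phi> (F + lip0_scale scaleK c G))"
      by (metis complex_Re_le_cmod norm_to_complex)
    also have "\<dots> \<le> ?m"
      by (rule limit_functional_norm_le[OF \<phi>(1)])
    finally show "l \<in> ?A"
      by simp
  qed
  ultimately have "convex hull (limit_set C F G) \<subseteq> ?A"
    by (rule hull_minimal[rotated])
  with assms have "0 \<in> ?A"
    by blast
  moreover have "?h 0 = 0"
    using linear_0[OF \<open>linear ?h\<close>] .
  ultimately show "norm F \<le> ?m"
    by simp
qed

lemma zero_in_hull_if_orthogonal:
  fixes F G :: "('m::{metric_space,zero}, 'y) lip0"
  assumes nontrivial: "\<exists>x::'m. x \<noteq> 0" "\<exists>y::'y. y \<noteq> 0"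
    and orth: "birkhoff_orthogonal (lip0_scale scaleK) F G"
  shows "0 \<in> convex hull (limit_set C F G)"
proof (rule ccontr)
  assume not0: "0 \<notin> convex hull (limit_set C F G)"
  \<comment> \<open>Separation takes place in the complex plane, a Euclidean space; the embedding is
    linear and injective, so \<open>0\<close> stays outside the hull.\<close>
  let ?T = "convex hull (to_complex ` limit_set C F G)"
  have "linear (to_complex :: 'k \<Rightarrow> complex)"
    by (rule bounded_linear.linear[OF bounded_linear_to_complex])
  then have T: "?T = to_complex ` (convex hull (limit_set C F G))"
    by (rule convex_hull_linear_image[symmetric])
  have "0 \<notin> ?T"
  proof
    assume "0 \<in> ?T"
    then obtain l where "l \<in> convex hull (limit_set C F G)" "to_complex l = 0"
      unfolding T by (metis imageE)
    with not0 show False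
      by simp
  qed
  moreover have "closed ?T"
    by (intro compact_imp_closed compact_convex_hull compact_continuous_image compact_limit_set
        linear_continuous_on bounded_linear_to_complex)
  ultimately obtain a b where "0 < b" and ab: "\<And>z. z \<in> ?T \<Longrightarrow> b < inner a z"
    using separating_hyperplane_closed_0[OF convex_convex_hull] by blast
  obtain c :: 'k where c: "\<And>l. Re (to_complex (c * l)) = inner (- a) (to_complex l)"
    using ex_scalar_inner by blast
  \<comment> \<open>Orthogonality is growth at rate \<open>0\<close> in every direction. The
    direction belonging to \<open>- a\<close> gives a limit point on the wrong side of the
    hyperplane.\<close>
  obtain l where l: "l \<in> limit_set C F G" "0 \<le> Re (to_complex (c * l))"
    using ex_limit_point_of_norm_growth[OF nontrivial, of F 0 c G] orth
    by (auto simp: birkhoff_orthogonal_def)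
  have "b < inner a (to_complex l)"
    using l(1) by (intro ab hull_inc) auto
  with \<open>0 < b\<close> l(2) c show False
    by simp
qed

section \<open>Support functionals and limit sets\<close>

text \<open>A support functional bounds the norm of every perturbation of \<open>F\<close> from
  below, with rate the real part of \<open>c * \<phi> G\<close>.\<close>

lemma limit_set_approximates_support:
  fixes F G :: "('m::{metric_space,zero}, 'y) lip0"
  assumes nontrivial: "\<exists>x::'m. x \<noteq> 0" "\<exists>y::'y. y \<noteq> 0"
    and \<phi>: "\<phi> \<in> dual_space (lip0_scale scaleK)" "onorm \<phi> = 1" "\<phi> F = of_real (norm F)"
  shows "\<exists>l\<in>limit_set C F G. Re (to_complex (c * \<phi> G)) \<le> Re (to_complex (c * l))"
proof (rule ex_limit_point_of_norm_growth[OF nontrivial])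
  fix r :: real
  assume "0 < r"
  let ?H = "F + lip0_scale scaleK (of_real r * c) G"
  have "\<phi> ?H = of_real (norm F) + of_real r * (c * \<phi> G)"
    by (simp add: dual_space_add[OF \<phi>(1)] dual_space_scale[OF \<phi>(1)] \<phi>(3) mult.assoc)
  then have "norm F + r * Re (to_complex (c * \<phi> G)) = Re (to_complex (\<phi> ?H))"
    by (simp add: to_complex_add to_complex_mult[of "of_real _"])
  also have "\<dots> \<le> norm (\<phi> ?H)"
    by (metis complex_Re_le_cmod norm_to_complex)
  also have "\<dots> \<le> norm ?H"
    using \<phi>(1,2) by (rule dual_space_norm_le)
  finally show "norm F + r * Re (to_complex (c * \<phi> G)) \<le> norm ?H" .
qed

lemma support_eq_if_limit_set_singleton:
  fixes F G :: "('m::{metric_space,zero}, 'y) lip0"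
  assumes nontrivial: "\<exists>x::'m. x \<noteq> 0" "\<exists>y::'y. y \<noteq> 0"
    and \<phi>: "\<phi> \<in> dual_space (lip0_scale scaleK)" "onorm \<phi> = 1" "\<phi> F = of_real (norm F)"
    and l: "limit_set C F G = {l}"
  shows "\<phi> G = l"
proof -
  \<comment> \<open>In the direction of the difference itself, the comparison says that the squared
    modulus of \<open>\<phi> G - l\<close> is at most \<open>0\<close>.\<close>
  obtain c where c: "\<And>z::'k. Re (to_complex (c * z)) = inner (to_complex (\<phi> G - l)) (to_complex z)"
    using ex_scalar_inner by blast
  have "Re (to_complex (c * \<phi> G)) \<le> Re (to_complex (c * l))"
    using limit_set_approximates_support[OF nontrivial \<phi>, of G c] l by auto
  then have "inner (to_complex (\<phi> G - l)) (to_complex (\<phi> G - l)) \<le> 0"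
    by (simp add: c to_complex_diff inner_diff_right)
  then have "to_complex (\<phi> G - l) = 0"
    by (metis inner_ge_zero inner_eq_zero_iff order_antisym)
  then show ?thesis
    by (simp add: to_complex_diff to_complex_eq_iff)
qed

lemma limit_functional_support:
  assumes "\<phi> \<in> limit_functionals C" "\<phi> F = of_real (norm F)" "F \<noteq> 0"
  shows "\<phi> \<in> dual_space (lip0_scale scaleK)" "onorm \<phi> = 1"
proof -
  show dual: "\<phi> \<in> dual_space (lip0_scale scaleK)"
    using assms(1) by (rule limit_functional_dual)
  have "onorm \<phi> \<le> 1"
    using limit_functional_norm_le[OF assms(1)] by (intro onorm_bound) auto
  moreover have "norm F \<le> onorm \<phi> * norm F"
    using onorm[of \<phi> F] dual assms(2) by (simp add: dual_space_def)
  ultimately show "onorm \<phi> = 1"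
    using assms(3) by simp
qed

section \<open>Degenerate spaces and the zero map\<close>

lemma nontrivial_if_lip0_nonzero:
  fixes F :: "('m::{metric_space,zero}, 'y) lip0"
  assumes "F \<noteq> 0"
  shows "\<exists>x::'m. x \<noteq> 0" "\<exists>y::'y. y \<noteq> 0"
proof -
  obtain x where "lip0_apply F x \<noteq> 0"
    using assms lip0_eqI[of F 0] by (auto simp: zero_lip0.rep_eq)
  moreover from this have "x \<noteq> 0"
    by (metis lip0_apply_0)
  ultimately show "\<exists>x::'m. x \<noteq> 0" "\<exists>y::'y. y \<noteq> 0"
    by blast+
qed

lemma ex_lip0_nonzero:
  assumes "\<exists>x::'m::{metric_space,zero}. x \<noteq> 0" "\<exists>y::'y. y \<noteq> 0"
  shows "\<exists>H::('m, 'y) lip0. H \<noteq> 0"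
proof -
  obtain x :: 'm and y :: 'y where xy: "x \<noteq> 0" "y \<noteq> 0"
    using assms by blast
  let ?f = "\<lambda>z::'m. dist z 0 *\<^sub>R y"
  have "lipschitz_on (norm y) UNIV ?f"
  proof (rule lipschitz_onI)
    fix s t :: 'm
    have "\<bar>dist s 0 - dist t 0\<bar> \<le> dist s t"
      by (metis abs_dist_diff_le dist_commute)
    then show "dist (?f s) (?f t) \<le> norm y * dist s t"
      by (simp add: dist_norm mult.commute mult_left_mono flip: scaleR_left_diff_distrib)
  qed simp
  then have "lip0_apply (Abs_lip0 ?f) = ?f"
    by (intro Abs_lip0_inverse) auto
  with xy have "lip0_apply (Abs_lip0 ?f) x \<noteq> lip0_apply 0 x"
    by (simp add: zero_lip0.rep_eq)
  then show ?thesis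
    by metis
qed

text \<open>A member of the limit set involves two distinct points and an element of
  \<open>C\<close>; the latter has norm one, which is impossible on the zero space.\<close>

lemma nontrivial_if_limit_set_nonempty:
  fixes F G :: "('m::{metric_space,zero}, 'y) lip0"
  assumes "limit_set C F G \<noteq> {}"
  shows "\<exists>x::'m. x \<noteq> 0" "\<exists>y::'y. y \<noteq> 0"
proof -
  obtain s t :: 'm and f where st: "s \<noteq> t" and "f \<in> C"
    using assms unfolding limit_set_def by blast
  show "\<exists>x::'m. x \<noteq> 0"
    using st by metis
  show "\<exists>y::'y. y \<noteq> 0"
  proof (rule ccontr)
    assume "\<not> ?thesis"
    moreover have "f 0 = 0"
      using dual_space_diff[OF C_dual(1)[OF \<open>f \<in> C\<close>], of 0 0] by simp
    ultimately have "f y = 0" for y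
      by metis
    then have "onorm f \<le> 0"
      by (intro onorm_bound) auto
    then show False
      using C_dual(2)[OF \<open>f \<in> C\<close>] by simp
  qed
qed

text \<open>From the zero map the norm grows at rate \<open>norm G\<close> in the directions
  \<open>1\<close> and \<open>- 1\<close>, so a single limit point would have real part both at
  least \<open>norm G\<close> and at most its negative.\<close>

lemma limit_set_0_not_singleton:
  fixes G :: "('m::{metric_space,zero}, 'y) lip0"
  assumes "G \<noteq> 0"
  shows "\<not> is_singleton (limit_set C 0 G)"
proof
  assume "is_singleton (limit_set C 0 G)"
  then obtain l where l: "limit_set C 0 G = {l}"
    by (auto simp: is_singleton_def)
  note growth = ex_limit_point_of_norm_growth[OF nontrivial_if_lip0_nonzero[OF assms],
      of 0 "norm G" _ G]
  have "norm G \<le> Re (to_complex (1 * l))"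
    using growth[of 1] l by (simp add: lip0.norm_scale norm_mult)
  moreover have "norm G \<le> Re (to_complex (- 1 * l))"
    using growth[of "- 1"] l by (simp add: lip0.norm_scale norm_mult)
  moreover have "Re (to_complex (- 1 * l)) = - Re (to_complex (1 * l))"
    by (simp add: to_complex_minus)
  moreover have "norm G > 0"
    using assms by simp
  ultimately show False
    by linarith
qed

section \<open>Smooth points\<close>

lemma limit_set_singleton_if_smooth:
  fixes F G :: "('m::{metric_space,zero}, 'y) lip0"
  assumes "smooth_point (lip0_scale scaleK) F"
  shows "is_singleton (limit_set C F G)"
proof -
  let ?S = "{\<phi> \<in> dual_space (lip0_scale scaleK). onorm \<phi> = 1 \<and> \<phi> F = of_real (norm F)}"
  obtain \<phi> where S: "?S = {\<phi>}"
    using assms unfolding smooth_point_def is_singleton_def by blast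
  then have \<phi>: "\<phi> \<in> dual_space (lip0_scale scaleK)" "onorm \<phi> = 1" "\<phi> F = of_real (norm F)"
    by auto
  have "\<exists>H. \<phi> H \<noteq> 0"
  proof (rule ccontr)
    assume "\<not> ?thesis"
    then have "onorm \<phi> \<le> 0"
      by (intro onorm_bound) auto
    with \<phi>(2) show False
      by simp
  qed
  then obtain H where H: "\<phi> H \<noteq> 0"
    by blast
  \<comment> \<open>At the zero map the negative of a support functional is again one, and it
    differs from \<phi> at \<open>H\<close>.\<close>
  have "F \<noteq> 0"
  proof
    assume "F = 0"
    then have "(\<lambda>x. - \<phi> x) \<in> ?S"
      using lip0.dual_space_uminus[OF \<phi>(1,2)] \<phi>(2,3) by (simp add: onorm_neg)
    then have "- \<phi> H = \<phi> H"
      using S by (metis singletonD)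
    then have "to_complex (\<phi> H + \<phi> H) = 0"
      by (metis add.left_inverse to_complex_eq_0_iff)
    then have "to_complex (\<phi> H) = 0"
      unfolding to_complex_add by simp
    with H show False
      by simp
  qed
  note nontrivial = nontrivial_if_lip0_nonzero[OF this]
  have "l = \<phi> G" if l: "l \<in> limit_set C F G" for l
  proof -
    obtain \<psi> where "\<psi> \<in> limit_functionals C" "\<psi> F = of_real (norm F)" "l = \<psi> G"
      using l unfolding limit_set_eq by blast
    moreover from limit_functional_support[OF this(1,2) \<open>F \<noteq> 0\<close>] this(2) have "\<psi> \<in> ?S"
      by simp
    then have "\<psi> = \<phi>"
      unfolding S by simp
    ultimately show ?thesis
      by simp
  qed
  moreover have "limit_set C F G \<noteq> {}"
    using ex_norm_attaining[OF nontrivial] unfolding limit_set_eq by blast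
  ultimately show ?thesis
    unfolding is_singleton_def by blast
qed

text \<open>Singletons are nonempty, which rules out trivial spaces and then \<open>F = 0\<close>. A
  support functional exists by norm attainment, and each of its values is forced by a singleton
  limit set.\<close>

lemma smooth_if_limit_sets_singleton:
  fixes F :: "('m::{metric_space,zero}, 'y) lip0"
  assumes "\<And>G :: ('m, 'y) lip0. is_singleton (limit_set C F G)"
  shows "smooth_point (lip0_scale scaleK) F"
proof -
  have "limit_set C F F \<noteq> {}"
    using assms[of F] by (auto simp: is_singleton_def)
  note nontrivial = nontrivial_if_limit_set_nonempty[OF this]
  have "F \<noteq> 0"
    using limit_set_0_not_singleton ex_lip0_nonzero[OF nontrivial] assms by metis
  obtain \<phi> where \<phi>: "\<phi> \<in> limit_functionals C" "\<phi> F = of_real (norm F)"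
    using ex_norm_attaining[OF nontrivial] by blast
  note support = limit_functional_support[OF \<phi> \<open>F \<noteq> 0\<close>]
  have "\<psi> = \<phi>" if "\<psi> \<in> dual_space (lip0_scale scaleK)" "onorm \<psi> = 1" "\<psi> F = of_real (norm F)" for \<psi>
  proof
    fix G
    obtain l where "limit_set C F G = {l}"
      using assms by (auto simp: is_singleton_def)
    then show "\<psi> G = \<phi> G"
      using support_eq_if_limit_set_singleton[OF nontrivial] that support \<phi>(2) by metis
  qed
  then have "{\<psi> \<in> dual_space (lip0_scale scaleK). onorm \<psi> = 1 \<and> \<psi> F = of_real (norm F)} = {\<phi>}"
    using support \<phi>(2) by blast
  then show ?thesis
    unfolding smooth_point_def is_singleton_def by blast
qed

end

text \<open>The premise of the first part excludes the zero Lipschitz space: there the limit set is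
  empty, although the zero map is orthogonal to itself. In the second part both sides fail in that
  case.\<close>

theorem proposition3p7:
  fixes scaleK :: "'k::rc_scalar \<Rightarrow> 'y::banach \<Rightarrow> 'y"
    and C :: "('y \<Rightarrow> 'k) set"
  assumes "normed_space_over scaleK"
    and "C \<subseteq> dual_sphere scaleK"
    and "one_norming C"
  shows "((\<exists>x::'m::{metric_space,zero}. x \<noteq> 0) \<and> (\<exists>y::'y. y \<noteq> 0) \<longrightarrow>
           (\<forall>F G :: ('m, 'y) lip0.
              birkhoff_orthogonal (lip0_scale scaleK) F G \<longleftrightarrow> 0 \<in> convex hull (limit_set C F G)))
       \<and> (\<forall>F :: ('m, 'y) lip0.
              smooth_point (lip0_scale scaleK) F \<longleftrightarrow>
              (\<forall>G :: ('m, 'y) lip0. is_singleton (limit_set C F G)))"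
proof -
  interpret one_norming_functionals scaleK C
    using assms by (simp add: one_norming_functionals_def one_norming_functionals_axioms_def)
  show ?thesis
  proof (intro conjI impI allI)
    fix F G :: "('m, 'y) lip0"
    assume "(\<exists>x::'m. x \<noteq> 0) \<and> (\<exists>y::'y. y \<noteq> 0)"
    then show "birkhoff_orthogonal (lip0_scale scaleK) F G \<longleftrightarrow> 0 \<in> convex hull (limit_set C F G)"
      by (elim conjE) (rule iffI[OF zero_in_hull_if_orthogonal orthogonal_if_0_in_hull])
  next
    fix F :: "('m, 'y) lip0"
    show "smooth_point (lip0_scale scaleK) F \<longleftrightarrow> (\<forall>G :: ('m, 'y) lip0. is_singleton (limit_set C F G))"
      by (intro iffI allI; rule limit_set_singleton_if_smooth smooth_if_limit_sets_singleton) simp_all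
  qed
qed

end
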